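(* Let $\gamma,\delta>0$ and let the Standing Assumption (stated in the context) be satisfied. Let $(\mathbf{z}_1,\mathbf{s}_1),(\mathbf{z}_2,\mathbf{s}_2)\in\mathcal{X}\times\mathcal{S}$ and $(\mathbf{z}_i^+,\mathbf{s}_i^+)=\mathbf{T}_{\mathrm{PD3O}}(\mathbf{z}_i,\mathbf{s}_i)$ for $i=1,2$, with $\mathbf{T}_{\mathrm{PD3O}}$ defined in the context. Then $$\|(\mathbf{z}_1^+,\mathbf{s}_1^+)-(\mathbf{z}_2^+,\mathbf{s}_2^+)\|_{\mathbf{I},\mathbf{M}}^2-\|(\mathbf{z}_1,\mathbf{s}_1)-(\mathbf{z}_2,\mathbf{s}_2)\|_{\mathbf{I},\mathbf{M}}^2\le-\frac{2\beta-\gamma}{2\beta}\,\|(\mathbf{z}_1^+,\mathbf{s}_1^+)-(\mathbf{z}_1,\mathbf{s}_1)-(\mathbf{z}_2^+,\mathbf{s}_2^+)+(\mathbf{z}_2,\mathbf{s}_2)\|_{\mathbf{I},\mathbf{M}}^2.$$ Furthermore, when $\mathbf{M}$ is positive definite and $\gamma\le2\beta$, the operator $\mathbf{T}_{\mathrm{PD3O}}$ is nonexpansive under the norm $\|(\cdot,\cdot)\|_{\mathbf{I},\mathbf{M}}$; more specifically, it is $\alpha$-averaged under this norm with $\alpha=\frac{2\beta}{4\beta-\gamma}$.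
   Context: $\mathcal{X}$ and $\mathcal{S}$ are real Hilbert spaces, $\mathbf{A}:\mathcal{X}\to\mathcal{S}$ is a bounded linear operator with adjoint $\mathbf{A}^\top$, $\mathbf{I}$ is the identity operator, and $\gamma,\delta>0$ are stepsizes. $f:\mathcal{X}\to\mathbb{R}$, $g:\mathcal{X}\to(-\infty,+\infty]$, $h,l:\mathcal{S}\to(-\infty,+\infty]$ are proper lower semi-continuous convex functions; $h^*,l^*$ denote convex conjugates; $f$ and $l^*:\mathcal{S}\to\mathbb{R}$ are differentiable with Lipschitz continuous gradients. For $\lambda>0$ and a proper lower semi-continuous convex function $\phi$, $\mathbf{prox}_{\lambda\phi}(\tilde{\mathbf{x}})=\arg\min_{\mathbf{x}}\lambda\phi(\mathbf{x})+\frac12\|\mathbf{x}-\tilde{\mathbf{x}}\|^2$. The operator $\mathbf{T}_{\mathrm{PD3O}}:\mathcal{X}\times\mathcal{S}\to\mathcal{X}\times\mathcal{S}$, $(\mathbf{z},\mathbf{s})\mapsto(\mathbf{z}^+,\mathbf{s}^+)$, is defined by $$\mathbf{x}=\mathbf{prox}_{\gamma g}(\mathbf{z}),$$ $$\mathbf{s}^+=\mathbf{prox}_{\delta h^*}\big((\mathbf{I}-\gamma\delta\mathbf{A}\mathbf{A}^\top)\mathbf{s}-\delta\nabla l^*(\mathbf{s})+\delta\mathbf{A}(2\mathbf{x}-\mathbf{z}-\gamma\nabla f(\mathbf{x}))\big),$$ $$\mathbf{z}^+=\mathbf{x}-\gamma\nabla f(\mathbf{x})-\gamma\mathbf{A}^\top\mathbf{s}^+.$$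 Let $\mathbf{M}=\frac{\gamma}{\delta}(\mathbf{I}-\gamma\delta\mathbf{A}\mathbf{A}^\top)$, $\langle\mathbf{s}_1,\mathbf{s}_2\rangle_{\mathbf{M}}=\langle\mathbf{s}_1,\mathbf{M}\mathbf{s}_2\rangle$, $\|\mathbf{s}\|_{\mathbf{M}}=\sqrt{\langle\mathbf{s},\mathbf{s}\rangle_{\mathbf{M}}}$ and $\|(\mathbf{z},\mathbf{s})\|_{\mathbf{I},\mathbf{M}}=\sqrt{\|\mathbf{z}\|^2+\|\mathbf{s}\|_{\mathbf{M}}^2}$ (when $\mathbf{M}$ is positive semidefinite, i.e. $\gamma\delta\|\mathbf{A}\mathbf{A}^\top\|\le1$). "Positive definite" means $\gamma\delta\|\mathbf{A}\mathbf{A}^\top\|<1$, so that $\mathbf{M}$ has a bounded inverse; then $\|\mathbf{s}\|_{\mathbf{M}^{-1}}=\sqrt{\langle\mathbf{s},\mathbf{M}^{-1}\mathbf{s}\rangle}$. Standing Assumption: there is $\beta>0$ such that for all $\mathbf{x}_1,\mathbf{x}_2\in\mathcal{X}$ and $\mathbf{s}_1,\mathbf{s}_2\in\mathcal{S}$, $$\langle\mathbf{x}_1-\mathbf{x}_2,\nabla f(\mathbf{x}_1)-\nabla f(\mathbf{x}_2)\rangle\ge\beta\|\nabla f(\mathbf{x}_1)-\nabla f(\mathbf{x}_2)\|^2,$$ $$\langle\mathbf{s}_1-\mathbf{s}_2,\nabla l^*(\mathbf{s}_1)-\nabla l^*(\mathbf{s}_2)\rangle\ge\beta\|\nabla l^*(\mathbf{s}_1)-\nabla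 l^*(\mathbf{s}_2)\|_{\mathbf{M}^{-1}}^2.$$ $\mathbf{M}$ is assumed positive definite if $\nabla l^*$ is not constant. If $\nabla l^*$ is constant, the second inequality is regarded as satisfied for any $\beta>0$ and $\mathbf{M}$ is only assumed positive semidefinite. An operator $\mathbf{T}$ is nonexpansive under a norm $\|\cdot\|$ if $\|\mathbf{T}u_1-\mathbf{T}u_2\|\le\|u_1-u_2\|$ for all $u_1,u_2$; it is $\alpha$-averaged, $\alpha\in(0,1]$, if $\|\mathbf{T}u_1-\mathbf{T}u_2\|^2\le\|u_1-u_2\|^2-\frac{1-\alpha}{\alpha}\|(\mathbf{I}-\mathbf{T})u_1-(\mathbf{I}-\mathbf{T})u_2\|^2$ for all $u_1,u_2$ (so $1$-averaged means nonexpansive). *)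

theory Defs
  imports "HOL-Analysis.Analysis"
begin

text \<open>
  Hilbert spaces are types of sort \<open>{real_inner, complete_space}\<close>. Functions with values in
  \<open>(-\<infinity>, +\<infinity>]\<close> are modelled as \<open>ereal\<close>-valued functions; properness excludes the value \<open>-\<infinity>\<close>.
\<close>

definition proper :: "('a \<Rightarrow> ereal) \<Rightarrow> bool" where
  "proper \<phi> \<longleftrightarrow> (\<forall>x. \<phi> x \<noteq> -\<infinity>) \<and> (\<exists>x. \<phi> x \<noteq> \<infinity>)"

definition lsc :: "('a::topological_space \<Rightarrow> ereal) \<Rightarrow> bool" where
  "lsc \<phi> \<longleftrightarrow> (\<forall>x. \<phi> x \<le> Liminf (at x) \<phi>)"

definition convex_ereal :: "('a::real_vector \<Rightarrow> ereal) \<Rightarrow> bool" where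
  "convex_ereal \<phi> \<longleftrightarrow> (\<forall>x y. \<forall>t\<in>{0<..<1}.
     \<phi> ((1 - t) *\<^sub>R x + t *\<^sub>R y) \<le> ereal (1 - t) * \<phi> x + ereal t * \<phi> y)"

definition proper_lsc_convex :: "('a::real_normed_vector \<Rightarrow> ereal) \<Rightarrow> bool" where
  "proper_lsc_convex \<phi> \<longleftrightarrow> proper \<phi> \<and> lsc \<phi> \<and> convex_ereal \<phi>"

definition conjugate :: "('a::real_inner \<Rightarrow> ereal) \<Rightarrow> 'a \<Rightarrow> ereal" where
  "conjugate \<phi> s = (SUP x. ereal (inner s x) - \<phi> x)"

definition prox :: "real \<Rightarrow> ('a::real_inner \<Rightarrow> ereal) \<Rightarrow> 'a \<Rightarrow> 'a" where
  "prox lam \<phi> v = (ARG_MIN (\<lambda>x. ereal lam * \<phi> x + ereal (1 / 2 * (norm (x - v))\<^sup>2)) x. True)"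

definition grad :: "('a::real_inner \<Rightarrow> real) \<Rightarrow> 'a \<Rightarrow> 'a" where
  "grad f x = (THE D. GDERIV f x :> D)"

definition lipschitz_smooth :: "('a::real_inner \<Rightarrow> real) \<Rightarrow> bool" where
  "lipschitz_smooth f \<longleftrightarrow>
     (\<forall>x. f differentiable (at x)) \<and> (\<exists>L. L-lipschitz_on UNIV (grad f))"

text \<open>
  Real-valued version of the conjugate; it agrees with \<^const>\<open>conjugate\<close> only where the latter
  is finite, so finiteness has to be assumed separately.
\<close>

definition conjugate_real :: "('a::real_inner \<Rightarrow> ereal) \<Rightarrow> 'a \<Rightarrow> real" where
  "conjugate_real \<phi> s = real_of_ereal (conjugate \<phi> s)"

definition T_PD3O ::
  "real \<Rightarrow> real \<Rightarrow> ('x::real_inner \<Rightarrow> 's::real_inner) \<Rightarrow> ('x \<Rightarrow> real) \<Rightarrow> ('x \<Rightarrow> ereal) \<Rightarrow>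
   ('s \<Rightarrow> ereal) \<Rightarrow> ('s \<Rightarrow> ereal) \<Rightarrow> 'x \<times> 's \<Rightarrow> 'x \<times> 's" where
  "T_PD3O \<gamma> \<delta> A f g h l = (\<lambda>(z, s).
     let x = prox \<gamma> g z;
         s' = prox \<delta> (conjugate h)
                ((s - (\<gamma> * \<delta>) *\<^sub>R A (adjoint A s)) - \<delta> *\<^sub>R grad (conjugate_real l) s
                  + \<delta> *\<^sub>R A (2 *\<^sub>R x - z - \<gamma> *\<^sub>R grad f x));
         z' = x - \<gamma> *\<^sub>R grad f x - \<gamma> *\<^sub>R adjoint A s'
     in (z', s'))"

definition M_op ::
  "real \<Rightarrow> real \<Rightarrow> ('x::real_inner \<Rightarrow> 's::real_inner) \<Rightarrow> 's \<Rightarrow> 's" where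
  "M_op \<gamma> \<delta> A s = (\<gamma> / \<delta>) *\<^sub>R (s - (\<gamma> * \<delta>) *\<^sub>R A (adjoint A s))"

definition M_pos_semidef ::
  "real \<Rightarrow> real \<Rightarrow> ('x::real_inner \<Rightarrow> 's::real_inner) \<Rightarrow> bool" where
  "M_pos_semidef \<gamma> \<delta> A \<longleftrightarrow> \<gamma> * \<delta> * onorm (A \<circ> adjoint A) \<le> 1"

text \<open>
  Positive definiteness is meant in the strong sense that makes \<^const>\<open>M_op\<close> boundedly
  invertible, not merely strict positivity of the quadratic form.
\<close>

definition M_pos_def ::
  "real \<Rightarrow> real \<Rightarrow> ('x::real_inner \<Rightarrow> 's::real_inner) \<Rightarrow> bool" where
  "M_pos_def \<gamma> \<delta> A \<longleftrightarrow> \<gamma> * \<delta> * onorm (A \<circ> adjoint A) < 1"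

definition weighted_norm :: "('s::real_inner \<Rightarrow> 's) \<Rightarrow> 's \<Rightarrow> real" where
  "weighted_norm M s = sqrt (inner s (M s))"

definition norm_IM :: "('s::real_inner \<Rightarrow> 's) \<Rightarrow> 'x::real_inner \<times> 's \<Rightarrow> real" where
  "norm_IM M = (\<lambda>(z, s). sqrt ((norm z)\<^sup>2 + (weighted_norm M s)\<^sup>2))"

text \<open>
  If the gradient of the conjugate of \<open>l\<close> is constant, its cocoercivity inequality is void and
  only positive semidefiniteness is required.
\<close>

definition standing_assumption ::
  "real \<Rightarrow> real \<Rightarrow> real \<Rightarrow> ('x::real_inner \<Rightarrow> 's::real_inner) \<Rightarrow> ('x \<Rightarrow> real) \<Rightarrow>
   ('s \<Rightarrow> ereal) \<Rightarrow> bool" where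
  "standing_assumption \<beta> \<gamma> \<delta> A f l \<longleftrightarrow>
     \<beta> > 0 \<and>
     (\<forall>x\<^sub>1 x\<^sub>2. inner (x\<^sub>1 - x\<^sub>2) (grad f x\<^sub>1 - grad f x\<^sub>2) \<ge> \<beta> * (norm (grad f x\<^sub>1 - grad f x\<^sub>2))\<^sup>2) \<and>
     (if grad (conjugate_real l) constant_on UNIV
      then M_pos_semidef \<gamma> \<delta> A
      else M_pos_def \<gamma> \<delta> A \<and>
        (\<forall>s\<^sub>1 s\<^sub>2. inner (s\<^sub>1 - s\<^sub>2) (grad (conjugate_real l) s\<^sub>1 - grad (conjugate_real l) s\<^sub>2)
           \<ge> \<beta> * (weighted_norm (inv (M_op \<gamma> \<delta> A))
                   (grad (conjugate_real l) s\<^sub>1 - grad (conjugate_real l) s\<^sub>2))\<^sup>2))"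

definition nonexpansive_under :: "('u::real_vector \<Rightarrow> real) \<Rightarrow> ('u \<Rightarrow> 'u) \<Rightarrow> bool" where
  "nonexpansive_under N T \<longleftrightarrow> (\<forall>u\<^sub>1 u\<^sub>2. N (T u\<^sub>1 - T u\<^sub>2) \<le> N (u\<^sub>1 - u\<^sub>2))"

definition averaged_under :: "('u::real_vector \<Rightarrow> real) \<Rightarrow> real \<Rightarrow> ('u \<Rightarrow> 'u) \<Rightarrow> bool" where
  "averaged_under N \<alpha> T \<longleftrightarrow> 0 < \<alpha> \<and> \<alpha> \<le> 1 \<and>
     (\<forall>u\<^sub>1 u\<^sub>2. (N (T u\<^sub>1 - T u\<^sub>2))\<^sup>2
        \<le> (N (u\<^sub>1 - u\<^sub>2))\<^sup>2 - (1 - \<alpha>) / \<alpha> * (N ((u\<^sub>1 - T u\<^sub>1) - (u\<^sub>2 - T u\<^sub>2)))\<^sup>2)"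

end

theory Submission
  imports Defs
begin

text \<open>
  Write every symbol for the difference of the two runs of the iteration: \<open>z\<close>, \<open>s\<close> for the inputs,
  \<open>z'\<close>, \<open>s'\<close> for the outputs, \<open>x\<close> for the inner proximal points, \<open>F\<close> and \<open>L\<close> for the gradients of
  \<open>f\<close> and of the conjugate of \<open>l\<close>. Proximal maps are firmly nonexpansive, which gives one inequality
  for each of the two proximal steps. The argument of the dual step minus its result \<open>s'\<close> is
  \<open>\<delta> / \<gamma>\<close> times \<open>M (s - s') - \<gamma> L + \<gamma> A (x - z + z')\<close>; this is where the metric \<open>M\<close> comes from. Expanding \<open>\<parallel>(z', s')\<parallel>\<^sup>2 - \<parallel>(z, s)\<parallel>\<^sup>2\<close> and inserting the two inequalities, all mixed terms
  cancel, and what exceeds \<open>- \<parallel>(z', s') - (z, s)\<parallel>\<^sup>2\<close> is at most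
  \<open>- 2 \<gamma> (\<langle>x, F\<rangle> + \<langle>z' - z, F\<rangle> + \<langle>s, L\<rangle> + \<langle>s' - s, L\<rangle>)\<close>.
  Cocoercivity bounds \<open>\<langle>x, F\<rangle>\<close> and \<open>\<langle>s, L\<rangle>\<close> from below by exactly the squares that Young's
  inequality needs to absorb the other two products, at the price of
  \<open>\<gamma> / (2 \<beta>) * \<parallel>(z', s') - (z, s)\<parallel>\<^sup>2\<close>. This is \<open>PD3O_energy_inequality\<close>. Averagedness is
  the same inequality, because \<open>(1 - \<alpha>) / \<alpha> = (2 \<beta> - \<gamma>) / (2 \<beta>)\<close>.

  The analytic input is that the objects exist: \<open>prox\<close>, \<open>adjoint\<close> and \<open>inv\<close> are defined by choice and
  mean something only once a minimizer, an adjoint or a preimage is known to exist. A single existence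
  result, \<open>prox_minimizer_exists\<close>, supplies most of this. Applied to a linear functional
  it gives the Riesz representation and hence adjoints; applied to \<open>h\<close> it gives an affine minorant of
  \<open>h\<close>, hence properness of the conjugate, whose proximal map is the one in the iteration. Preimages
  under a positive definite \<open>M\<close> come from Banach's fixed point theorem.
\<close>

section \<open>Proximal points of proper lower semicontinuous convex functions\<close>

lemma lsc_iff_eventually:
  "lsc \<phi> \<longleftrightarrow> (\<forall>x c. c < \<phi> x \<longrightarrow> eventually (\<lambda>y. c < \<phi> y) (nhds x))"
  unfolding lsc_def le_Liminf_iff by (auto simp: eventually_nhds_conv_at)

lemma proper_finite_point:
  assumes "proper \<phi>" obtains x r where "\<phi> x = ereal r"
  using assms unfolding proper_def by (metis ereal_cases)

lemma convex_erealD: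
  assumes "convex_ereal \<phi>" "\<phi> x \<le> ereal a" "\<phi> y \<le> ereal b" "0 < t" "t < 1"
  shows "\<phi> ((1 - t) *\<^sub>R x + t *\<^sub>R y) \<le> ereal ((1 - t) * a + t * b)"
proof -
  have "\<phi> ((1 - t) *\<^sub>R x + t *\<^sub>R y) \<le> ereal (1 - t) * \<phi> x + ereal t * \<phi> y"
    using assms unfolding convex_ereal_def by auto
  also have "\<dots> \<le> ereal (1 - t) * ereal a + ereal t * ereal b"
    by (intro add_mono ereal_mult_left_mono) (use assms in auto)
  finally show ?thesis by simp
qed

lemma epigraph_sequentially_closed:
  assumes "lsc \<phi>" "\<And>n::nat. \<phi> (x n) \<le> ereal (r n)" "x \<longlonglongrightarrow> p" "r \<longlonglongrightarrow> \<rho>"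
  shows "\<phi> p \<le> ereal \<rho>"
proof (rule ccontr)
  assume "\<not> \<phi> p \<le> ereal \<rho>"
  then obtain c where c: "ereal \<rho> < ereal c" "ereal c < \<phi> p"
    using ereal_dense2 by (metis not_le)
  have "eventually (\<lambda>y. ereal c < \<phi> y) (nhds p)"
    using assms(1) c(2) unfolding lsc_iff_eventually by blast
  then have 1: "eventually (\<lambda>n. ereal c < \<phi> (x n)) sequentially"
    using filterlim_iff[THEN iffD1, OF assms(3)] by blast
  have 2: "eventually (\<lambda>n. r n < c) sequentially"
    using order_tendstoD(2)[OF assms(4)] c(1) by simp
  have "eventually (\<lambda>n::nat. False) sequentially"
    using 1 2
  proof eventually_elim
    case (elim n)
    then have "ereal c < ereal (r n)" using assms(2) order_less_le_trans by blast
    then show False using elim by simp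
  qed
  then show False by simp
qed

text \<open>
  Lower semicontinuity bounds \<open>\<phi>\<close> below on a small ball around a point of its domain, and
  convexity along rays from the centre propagates the bound to the whole space with linear loss.
  The square in the proximal objective dominates such a loss.
\<close>

lemma lsc_convex_linear_minorant:
  fixes \<phi> :: "'a::real_normed_vector \<Rightarrow> ereal"
  assumes "proper_lsc_convex \<phi>"
  obtains x\<^sub>0 K b where "K \<ge> 0" "\<And>x. ereal (b - K * norm (x - x\<^sub>0)) \<le> \<phi> x"
proof -
  have cvx: "convex_ereal \<phi>" and lsc: "lsc \<phi>" and pr: "proper \<phi>"
    using assms unfolding proper_lsc_convex_def by auto
  obtain x\<^sub>0 a where a: "\<phi> x\<^sub>0 = ereal a" using proper_finite_point[OF pr] .
  have "eventually (\<lambda>y. ereal (a - 1) < \<phi> y) (nhds x\<^sub>0)"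
    using lsc a unfolding lsc_iff_eventually by simp
  then obtain d where d: "d > 0" "\<And>y. dist y x\<^sub>0 < d \<Longrightarrow> ereal (a - 1) < \<phi> y"
    unfolding eventually_nhds_metric by auto
  define r where "r = d / 2"
  have r: "r > 0" "\<And>y. norm (y - x\<^sub>0) \<le> r \<Longrightarrow> ereal (a - 1) < \<phi> y"
    using d by (auto simp: r_def dist_norm)
  have "ereal ((a - 1) - (1 / r) * norm (x - x\<^sub>0)) \<le> \<phi> x" for x
  proof (cases "norm (x - x\<^sub>0) \<le> r")
    case True
    have "ereal ((a - 1) - (1 / r) * norm (x - x\<^sub>0)) \<le> ereal (a - 1)" using r by simp
    with r(2)[OF True] show ?thesis by (meson order.strict_implies_order order_trans)
  next
    case False
    show ?thesis
    proof (cases "\<phi> x")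
      case (real b)
      \<comment> \<open>the point of the segment from \<open>x\<^sub>0\<close> to \<open>x\<close> that lies on the sphere of radius \<open>r\<close>\<close>
      define t where "t = r / norm (x - x\<^sub>0)"
      have t: "0 < t" "t < 1" using False r by (auto simp: t_def divide_simps)
      let ?y = "(1 - t) *\<^sub>R x\<^sub>0 + t *\<^sub>R x"
      have "?y - x\<^sub>0 = t *\<^sub>R (x - x\<^sub>0)" by (simp add: algebra_simps)
      moreover have "norm (t *\<^sub>R (x - x\<^sub>0)) = r" using r False by (auto simp: t_def)
      ultimately have "ereal (a - 1) < \<phi> ?y" using r(2)[of ?y] by simp
      also have "\<dots> \<le> ereal ((1 - t) * a + t * b)"
        using convex_erealD[OF cvx _ _ t] a real by simp
      finally have "t * (a - b) < 1" by (simp add: algebra_simps)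
      then have "a - b < 1 / t" using t by (simp add: field_simps)
      then show ?thesis using real by (simp add: t_def)
    qed (use pr in \<open>auto simp: proper_def\<close>)
  qed
  with that[of "1 / r" "a - 1" x\<^sub>0] r show thesis by simp
qed

lemma half_sum_norm_identity:
  fixes x y v :: "'a::real_inner"
  shows "(norm ((1/2) *\<^sub>R x + (1/2) *\<^sub>R y - v))\<^sup>2
    = ((norm (x - v))\<^sup>2 + (norm (y - v))\<^sup>2) / 2 - (norm (x - y))\<^sup>2 / 4"
  unfolding power2_norm_eq_inner
  by (simp add: inner_simps inner_commute field_simps)

text \<open>
  The problem is to minimize \<open>V (x, r) = lam r + \<parallel>x - v\<parallel>\<^sup>2 / 2\<close> over the epigraph of \<open>\<phi>\<close>, which keeps
  all values real. The square makes \<open>V\<close> coercive against the linear minorant, and strongly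
  convex in \<open>x\<close>: comparing two almost optimal points with their midpoint shows that a minimizing
  sequence is Cauchy. Its limit exists by completeness and stays in the epigraph by lower
  semicontinuity.
\<close>

lemma prox_minimizer_exists:
  fixes \<phi> :: "'a::{real_inner, complete_space} \<Rightarrow> ereal"
  assumes \<phi>: "proper_lsc_convex \<phi>" and lam: "lam > 0"
  shows "\<exists>p. is_arg_min (\<lambda>x. ereal lam * \<phi> x + ereal (1 / 2 * (norm (x - v))\<^sup>2)) (\<lambda>_. True) p"
proof -
  have cvx: "convex_ereal \<phi>" and lsc: "lsc \<phi>" and pr: "proper \<phi>"
    using \<phi> unfolding proper_lsc_convex_def by auto
  define V where "V = (\<lambda>(x, r). lam * r + 1 / 2 * (norm (x - v))\<^sup>2)"
  have V_pair: "V (x, r) = lam * r + 1 / 2 * (norm (x - v))\<^sup>2" for x r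
    by (simp add: V_def)
  define E where "E = {(x, r). \<phi> x \<le> ereal r}"
  obtain x\<^sub>0 K b where K: "K \<ge> 0" "\<And>x. ereal (b - K * norm (x - x\<^sub>0)) \<le> \<phi> x"
    by (rule lsc_convex_linear_minorant[OF \<phi>]) (rule that)
  have V_below: "lam * (b - K * norm (v - x\<^sub>0)) - (lam * K)\<^sup>2 / 2 \<le> V e" if "e \<in> E" for e
  proof -
    obtain x r where e: "e = (x, r)" by force
    define n where "n = norm (x - v)"
    have "ereal (b - K * norm (x - x\<^sub>0)) \<le> ereal r"
      using that e unfolding E_def by (intro order_trans[OF K(2)]) simp
    then have "b - K * norm (x - x\<^sub>0) \<le> r" by simp
    moreover have "K * norm (x - x\<^sub>0) \<le> K * (n + norm (v - x\<^sub>0))"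
      unfolding n_def using K(1) norm_triangle_ineq[of "x - v" "v - x\<^sub>0"]
      by (intro mult_left_mono) auto
    ultimately have "b - K * (n + norm (v - x\<^sub>0)) \<le> r" by linarith
    then have "lam * (b - K * (n + norm (v - x\<^sub>0))) \<le> lam * r" using lam by simp
    moreover have "0 \<le> (n - lam * K)\<^sup>2" by simp
    ultimately show ?thesis
      by (simp add: e V_def n_def[symmetric] power2_eq_square algebra_simps)
  qed
  then have bdd: "bdd_below (V ` E)" by (meson bdd_belowI2)
  obtain x r where "\<phi> x = ereal r" using proper_finite_point[OF pr] .
  then have "(x, r) \<in> E" by (simp add: E_def)
  then have ne: "V ` E \<noteq> {}" by blast
  define m where "m = Inf (V ` E)"
  have m_le: "m \<le> V e" if "e \<in> E" for e
    unfolding m_def using bdd that by (intro cInf_lower) auto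
  have "\<exists>e\<in>E. V e < m + 1 / real (Suc n)" for n
    using cInf_lessD[OF ne, of "m + 1 / real (Suc n)"] unfolding m_def by auto
  then obtain e where e: "\<And>n. e n \<in> E" "\<And>n. V (e n) < m + 1 / real (Suc n)" by metis
  define X where "X = (\<lambda>n. fst (e n))"
  define R where "R = (\<lambda>n. snd (e n))"
  have XR: "\<phi> (X n) \<le> ereal (R n)" for n
    using e(1)[of n] unfolding E_def X_def R_def by (simp add: case_prod_beta)
  have VXR: "V (e n) = lam * R n + 1 / 2 * (norm (X n - v))\<^sup>2" for n
    unfolding V_def X_def R_def by (simp add: case_prod_beta)
  have dist_bound: "(norm (X i - X j))\<^sup>2 < 8 * (1 / real (Suc N))" if "i \<ge> N" "j \<ge> N" for i j N
  proof -
    define c where "c = 1 / real (Suc N)"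
    let ?x = "(1/2) *\<^sub>R X i + (1/2) *\<^sub>R X j" and ?r = "(1/2) * R i + (1/2) * R j"
    have "\<phi> ?x \<le> ereal ?r" using convex_erealD[OF cvx XR[of i] XR[of j], of "1/2"] by simp
    then have "m \<le> V (?x, ?r)" by (intro m_le) (simp add: E_def)
    also have "\<dots> = (V (e i) + V (e j)) / 2 - (norm (X i - X j))\<^sup>2 / 8"
      unfolding VXR V_pair half_sum_norm_identity by (simp add: field_simps)
    finally have "(norm (X i - X j))\<^sup>2 \<le> 4 * (V (e i) + V (e j)) - 8 * m" by argo
    moreover have "V (e k) < m + c" if "k \<ge> N" for k
    proof -
      have "1 / real (Suc k) \<le> c" unfolding c_def using that by (intro divide_left_mono) auto
      with e(2)[of k] show ?thesis by simp
    qed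
    note this[OF \<open>i \<ge> N\<close>] this[OF \<open>j \<ge> N\<close>]
    ultimately have "(norm (X i - X j))\<^sup>2 < 8 * c" by argo
    then show ?thesis by (simp add: c_def)
  qed
  have "Cauchy X"
  proof (rule metric_CauchyI)
    fix \<epsilon> :: real assume \<epsilon>: "\<epsilon> > 0"
    obtain N where N: "8 / \<epsilon>\<^sup>2 < real N" using reals_Archimedean2 by blast
    have "8 * (1 / real (Suc N)) < \<epsilon>\<^sup>2" using N \<epsilon> by (simp add: field_simps pos_add_strict)
    then have "dist (X i) (X j) < \<epsilon>" if "i \<ge> N" "j \<ge> N" for i j
      using dist_bound[OF that] \<epsilon> unfolding dist_norm 
      by (auto intro: power2_less_imp_less order_less_trans)
    then show "\<exists>N. \<forall>i\<ge>N. \<forall>j\<ge>N. dist (X i) (X j) < \<epsilon>" by blast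
  qed
  then obtain p where p: "X \<longlonglongrightarrow> p" using Cauchy_convergent convergent_def by blast
  have V_lim: "(\<lambda>n. V (e n)) \<longlonglongrightarrow> m"
  proof (rule tendsto_sandwich)
    show "\<forall>\<^sub>F n in sequentially. m \<le> V (e n)" using m_le e by auto
    show "\<forall>\<^sub>F n in sequentially. V (e n) \<le> m + 1 / real (Suc n)"
      by (rule always_eventually) (use e(2) less_imp_le in blast)
    show "(\<lambda>n. m + 1 / real (Suc n)) \<longlonglongrightarrow> m"
      using tendsto_add[OF tendsto_const[of m] LIMSEQ_inverse_real_of_nat]
      by (simp add: inverse_eq_divide)
  qed simp
  define \<rho> where "\<rho> = (m - 1 / 2 * (norm (p - v))\<^sup>2) / lam"
  have "(\<lambda>n. (V (e n) - 1 / 2 * (norm (X n - v))\<^sup>2) / lam) \<longlonglongrightarrow> \<rho>"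
    unfolding \<rho>_def using lam by (intro tendsto_intros V_lim p) auto
  moreover have "(\<lambda>n. (V (e n) - 1 / 2 * (norm (X n - v))\<^sup>2) / lam) = R"
    using lam by (simp add: VXR)
  ultimately have "R \<longlonglongrightarrow> \<rho>" by simp
  then have p\<rho>: "\<phi> p \<le> ereal \<rho>" using epigraph_sequentially_closed[OF lsc XR p] by simp
  have "ereal lam * \<phi> p + ereal (1 / 2 * (norm (p - v))\<^sup>2)
      \<le> ereal lam * ereal \<rho> + ereal (1 / 2 * (norm (p - v))\<^sup>2)"
    using p\<rho> lam by (intro add_mono ereal_mult_left_mono) auto
  also have "\<dots> = ereal m" using lam by (simp add: \<rho>_def)
  finally have pm: "ereal lam * \<phi> p + ereal (1 / 2 * (norm (p - v))\<^sup>2) \<le> ereal m" .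
  have "ereal m \<le> ereal lam * \<phi> y + ereal (1 / 2 * (norm (y - v))\<^sup>2)" for y
  proof (cases "\<phi> y")
    case (real r)
    then have "m \<le> V (y, r)" by (intro m_le) (simp add: E_def)
    then show ?thesis using real by (simp add: V_def)
  qed (use pr lam in \<open>auto simp: proper_def\<close>)
  with pm have "is_arg_min (\<lambda>x. ereal lam * \<phi> x + ereal (1 / 2 * (norm (x - v))\<^sup>2)) (\<lambda>_. True) p"
    unfolding is_arg_min_def by (meson leD order_trans)
  then show ?thesis by blast
qed

lemma nonneg_of_perturbations:
  fixes c d :: real
  assumes "\<And>t. 0 < t \<Longrightarrow> t < 1 \<Longrightarrow> 0 \<le> c + t * d"
  shows "0 \<le> c"
proof -
  have "((\<lambda>t. c + t * d) \<longlongrightarrow> c + 0 * d) (at_right 0)" by (intro tendsto_intros)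
  moreover have "eventually (\<lambda>t. 0 \<le> c + t * d) (at_right (0::real))"
    using eventually_at_right_less[of 0] eventually_at_right_real[of 0 1]
    by (auto elim!: eventually_mono intro: assms)
  ultimately show ?thesis using tendsto_lowerbound[of _ "c + 0 * d"] by fastforce
qed

text \<open>
  First order optimality of the proximal point \<open>p\<close>: moving from \<open>p\<close> towards \<open>y\<close> by a fraction \<open>t\<close>
  cannot decrease the objective; divide by \<open>t\<close> and let \<open>t\<close> tend to \<open>0\<close>. In other words,
  \<open>(v - p) / lam\<close> is a subgradient of \<open>\<phi>\<close> at \<open>p\<close>.
\<close>

lemma prox_variational_inequality:
  fixes \<phi> :: "'a::{real_inner, complete_space} \<Rightarrow> ereal"
  assumes \<phi>: "proper_lsc_convex \<phi>" and lam: "lam > 0"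
  obtains a where "\<phi> (prox lam \<phi> v) = ereal a"
    "\<And>y b. \<phi> y = ereal b \<Longrightarrow> inner (v - prox lam \<phi> v) (y - prox lam \<phi> v) \<le> lam * (b - a)"
proof -
  have cvx: "convex_ereal \<phi>" and pr: "proper \<phi>"
    using \<phi> unfolding proper_lsc_convex_def by auto
  define p where "p = prox lam \<phi> v"
  have "is_arg_min (\<lambda>x. ereal lam * \<phi> x + ereal (1 / 2 * (norm (x - v))\<^sup>2)) (\<lambda>_. True) p"
    unfolding p_def prox_def arg_min_def using someI_ex[OF prox_minimizer_exists[OF \<phi> lam]] .
  then have min: "ereal lam * \<phi> p + ereal (1 / 2 * (norm (p - v))\<^sup>2)
      \<le> ereal lam * \<phi> y + ereal (1 / 2 * (norm (y - v))\<^sup>2)" for y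
    unfolding is_arg_min_def by (simp add: not_less)
  obtain x r where x: "\<phi> x = ereal r" using proper_finite_point[OF pr] .
  obtain a where a: "\<phi> p = ereal a"
    using min[of x] x pr lam by (cases "\<phi> p") (auto simp: proper_def)
  have "inner (v - p) (y - p) \<le> lam * (b - a)" if y: "\<phi> y = ereal b" for y b
  proof -
    have "0 \<le> (lam * (b - a) - inner (v - p) (y - p)) + t * ((norm (y - p))\<^sup>2 / 2)"
      if t: "0 < t" "t < 1" for t
    proof -
      let ?y = "(1 - t) *\<^sub>R p + t *\<^sub>R y"
      have "ereal (lam * a + 1 / 2 * (norm (p - v))\<^sup>2)
          \<le> ereal lam * \<phi> ?y + ereal (1 / 2 * (norm (?y - v))\<^sup>2)"
        using min[of ?y] a by simp
      also have "\<dots> \<le> ereal lam * ereal ((1 - t) * a + t * b) + ereal (1 / 2 * (norm (?y - v))\<^sup>2)"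
        using convex_erealD[OF cvx _ _ t, of p a y b] a y lam
        by (intro add_mono ereal_mult_left_mono) auto
      finally have "lam * a + 1 / 2 * (norm (p - v))\<^sup>2
          \<le> lam * ((1 - t) * a + t * b) + 1 / 2 * (norm (?y - v))\<^sup>2" by simp
      moreover have "(norm (?y - v))\<^sup>2
          = (norm (p - v))\<^sup>2 - 2 * t * inner (v - p) (y - p) + t * t * (norm (y - p))\<^sup>2"
      proof -
        have "?y - v = (p - v) + t *\<^sub>R (y - p)" by (simp add: algebra_simps)
        then show ?thesis unfolding power2_norm_eq_inner
          by (simp add: inner_simps inner_commute algebra_simps)
      qed
      ultimately have "0 \<le> t * ((lam * (b - a) - inner (v - p) (y - p)) + t * ((norm (y - p))\<^sup>2 / 2))"
        by (simp add: algebra_simps)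
      then show ?thesis using t by (simp add: zero_le_mult_iff)
    qed
    then have "0 \<le> lam * (b - a) - inner (v - p) (y - p)" by (rule nonneg_of_perturbations)
    then show ?thesis by simp
  qed
  then show thesis using that a unfolding p_def by blast
qed

text \<open>
  Monotonicity of the subdifferential: add the variational inequality of each proximal point,
  tested with the other one.
\<close>

lemma prox_firmly_nonexpansive:
  fixes \<phi> :: "'a::{real_inner, complete_space} \<Rightarrow> ereal"
  assumes "proper_lsc_convex \<phi>" "lam > 0"
  shows "0 \<le> inner ((v - prox lam \<phi> v) - (w - prox lam \<phi> w)) (prox lam \<phi> v - prox lam \<phi> w)"
proof -
  obtain a where a: "\<phi> (prox lam \<phi> v) = ereal a"
    "\<And>y b. \<phi> y = ereal b \<Longrightarrow> inner (v - prox lam \<phi> v) (y - prox lam \<phi> v) \<le> lam * (b - a)"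
    using prox_variational_inequality[OF assms] by blast
  obtain b where b: "\<phi> (prox lam \<phi> w) = ereal b"
    "\<And>y b'. \<phi> y = ereal b' \<Longrightarrow> inner (w - prox lam \<phi> w) (y - prox lam \<phi> w) \<le> lam * (b' - b)"
    using prox_variational_inequality[OF assms] by blast
  show ?thesis using a(2)[OF b(1)] b(2)[OF a(1)] by (simp add: inner_simps algebra_simps)
qed

section \<open>Convex conjugates\<close>

lemma conjugate_ge:
  assumes "h x = ereal c" shows "ereal (inner s x - c) \<le> conjugate h s"
  unfolding conjugate_def using assms by (intro SUP_upper2[of x]) auto

lemma conjugate_le:
  assumes "proper h" "\<And>x c. h x = ereal c \<Longrightarrow> inner s x - c \<le> b"
  shows "conjugate h s \<le> ereal b"
  unfolding conjugate_def
proof (rule SUP_least)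
  fix x show "ereal (inner s x) - h x \<le> ereal b"
    using assms by (cases "h x") (auto simp: proper_def)
qed

text \<open>
  As a supremum of affine functions the conjugate is lower semicontinuous and convex. That it is
  finite somewhere needs an affine minorant of \<open>h\<close>, and the variational inequality for the proximal
  point of \<open>0\<close> is one.
\<close>

lemma proper_lsc_convex_conjugate:
  fixes h :: "'a::{real_inner, complete_space} \<Rightarrow> ereal"
  assumes h: "proper_lsc_convex h"
  shows "proper_lsc_convex (conjugate h)"
proof -
  have pr: "proper h" using h unfolding proper_lsc_convex_def by auto
  obtain x\<^sub>0 c\<^sub>0 where x\<^sub>0: "h x\<^sub>0 = ereal c\<^sub>0" using proper_finite_point[OF pr] .
  have not_minf: "conjugate h s \<noteq> -\<infinity>" for s
    using conjugate_ge[where h = h, OF x\<^sub>0, of s] by auto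
  define p where "p = prox 1 h 0"
  obtain a where a: "h p = ereal a" "\<And>y b. h y = ereal b \<Longrightarrow> inner (0 - p) (y - p) \<le> 1 * (b - a)"
    using prox_variational_inequality[OF h zero_less_one, of 0] unfolding p_def by blast
  have "conjugate h (- p) \<le> ereal (inner (- p) p - a)"
  proof (rule conjugate_le[OF pr])
    fix x c assume "h x = ereal c"
    from a(2)[OF this] show "inner (- p) x - c \<le> inner (- p) p - a"
      by (simp add: inner_simps)
  qed
  then have "conjugate h (- p) \<noteq> \<infinity>" by auto
  with not_minf have 1: "proper (conjugate h)" unfolding proper_def by blast
  have 2: "lsc (conjugate h)"
    unfolding lsc_iff_eventually
  proof (intro allI impI)
    fix s c assume "c < conjugate h s"
    then obtain x where x: "c < ereal (inner s x) - h x"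
      unfolding conjugate_def less_SUP_iff by auto
    then obtain b where b: "h x = ereal b"
      using pr by (cases "h x") (auto simp: proper_def)
    have "((\<lambda>y. ereal (inner y x - b)) \<longlongrightarrow> ereal (inner s x - b)) (nhds s)"
      by (intro tendsto_intros filterlim_ident)
    from order_tendstoD(1)[OF this, of c]
    have "eventually (\<lambda>y. c < ereal (inner y x - b)) (nhds s)" using x b by simp
    then show "eventually (\<lambda>y. c < conjugate h y) (nhds s)"
      by (rule eventually_mono) (use conjugate_ge[where h = h, OF b] in \<open>blast intro: order_less_le_trans\<close>)
  qed
  have 3: "convex_ereal (conjugate h)"
    unfolding convex_ereal_def
  proof (intro allI ballI)
    fix s s' :: 'a and t :: real assume t: "t \<in> {0<..<1}"
    show "conjugate h ((1 - t) *\<^sub>R s + t *\<^sub>R s')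
        \<le> ereal (1 - t) * conjugate h s + ereal t * conjugate h s'"
    proof (cases "conjugate h s = \<infinity> \<or> conjugate h s' = \<infinity>")
      case True
      then show ?thesis using t not_minf[of s] not_minf[of s']
        by (cases "conjugate h s"; cases "conjugate h s'") auto
    next
      case False
      then obtain a b where ab: "conjugate h s = ereal a" "conjugate h s' = ereal b"
        using not_minf by (metis ereal_cases)
      have "conjugate h ((1 - t) *\<^sub>R s + t *\<^sub>R s') \<le> ereal ((1 - t) * a + t * b)"
      proof (rule conjugate_le[OF pr])
        fix x c assume x: "h x = ereal c"
        have "(1 - t) * (inner s x - c) + t * (inner s' x - c) \<le> (1 - t) * a + t * b"
          using conjugate_ge[where h = h, OF x, of s] conjugate_ge[where h = h, OF x, of s'] ab t
          by (intro add_mono mult_left_mono) auto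
        then show "inner ((1 - t) *\<^sub>R s + t *\<^sub>R s') x - c \<le> (1 - t) * a + t * b"
          by (simp add: inner_simps algebra_simps)
      qed
      then show ?thesis using ab by simp
    qed
  qed
  show ?thesis unfolding proper_lsc_convex_def using 1 2 3 by blast
qed

section \<open>Adjoints in Hilbert spaces\<close>

text \<open>
  Makes the existence of proximal points applicable to linear functionals, with Riesz'
  theorem in view.
\<close>

lemma proper_lsc_convex_bounded_linear:
  fixes L :: "'a::real_normed_vector \<Rightarrow> real"
  assumes "bounded_linear L"
  shows "proper_lsc_convex (\<lambda>x. ereal (L x))"
proof -
  interpret bounded_linear L by fact
  have "lsc (\<lambda>x. ereal (L x))"
    unfolding lsc_iff_eventually
  proof (intro allI impI)
    fix x c assume "c < ereal (L x)"
    have "((\<lambda>y. ereal (L y)) \<longlongrightarrow> ereal (L x)) (nhds x)"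
      by (intro tendsto_intros tendsto filterlim_ident)
    then show "eventually (\<lambda>y. c < ereal (L y)) (nhds x)"
      using \<open>c < ereal (L x)\<close> by (rule order_tendstoD)
  qed
  then show ?thesis
    unfolding proper_lsc_convex_def proper_def convex_ereal_def by (auto simp: add scaleR)
qed

text \<open>
  The minimizer \<open>p\<close> of \<open>L x + \<parallel>x\<parallel>\<^sup>2 / 2\<close> satisfies \<open>\<langle>- p, x\<rangle> \<le> L x\<close> for all \<open>x\<close>; replacing \<open>x\<close> by \<open>- x\<close>
  turns this into an equation.
\<close>

theorem Riesz_representation:
  fixes L :: "'a::{real_inner, complete_space} \<Rightarrow> real"
  assumes "bounded_linear L"
  obtains w where "\<And>x. L x = inner w x"
proof -
  interpret bounded_linear L by fact
  define p where "p = prox 1 (\<lambda>x. ereal (L x)) 0"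
  obtain a where a: "ereal (L p) = ereal a"
    "\<And>y b. ereal (L y) = ereal b \<Longrightarrow> inner (0 - p) (y - p) \<le> 1 * (b - a)"
    using prox_variational_inequality[OF proper_lsc_convex_bounded_linear[OF assms] zero_less_one,
        of 0] unfolding p_def by blast
  have le: "inner (- p) x \<le> L x" for x
    using a(2)[of "p + x" "L (p + x)"] a(1) by (simp add: add)
  have "L x = inner (- p) x" for x
    using le[of x] le[of "- x"] by (simp add: neg)
  then show thesis using that by blast
qed

text \<open>
  The constant \<^const>\<open>adjoint\<close> is a choice among maps with this property, so Riesz representation
  of \<open>\<lambda>x. \<langle>A x, y\<rangle>\<close> is what gives it content beyond finite dimension.
\<close>

lemma inner_adjoint:
  fixes A :: "'x::{real_inner, complete_space} \<Rightarrow> 's::real_inner"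
  assumes "bounded_linear A"
  shows "inner (A x) y = inner x (adjoint A y)"
proof -
  have "\<exists>w. \<forall>x. inner (A x) y = inner x w" for y
  proof -
    have "bounded_linear (\<lambda>x. inner (A x) y)"
      using assms by (rule bounded_linear_inner_left_comp)
    from Riesz_representation[OF this] show ?thesis by (metis inner_commute)
  qed
  then have "\<exists>B. \<forall>x y. inner (A x) y = inner x (B y)" by metis
  from someI_ex[OF this] show ?thesis unfolding adjoint_def by blast
qed

lemma bounded_linear_adjoint:
  fixes A :: "'x::{real_inner, complete_space} \<Rightarrow> 's::real_inner"
  assumes A: "bounded_linear A"
  shows "bounded_linear (adjoint A)"
proof -
  obtain K where K: "K \<ge> 0" "\<And>x. norm (A x) \<le> norm x * K"
    using bounded_linear.nonneg_bounded[OF A] by blast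
  note ad = inner_adjoint[OF A, symmetric]
  show ?thesis
  proof (rule bounded_linear_intro[where K = K])
    show "adjoint A (x + y) = adjoint A x + adjoint A y" for x y
      by (rule vector_eq_ldot[THEN iffD1]) (simp add: ad inner_add_right)
    show "adjoint A (r *\<^sub>R x) = r *\<^sub>R adjoint A x" for r x
      by (rule vector_eq_ldot[THEN iffD1]) (simp add: ad)
    show "norm (adjoint A y) \<le> norm y * K" for y
    proof (cases "adjoint A y = 0")
      case False
      have "norm (adjoint A y) * norm (adjoint A y) = inner (A (adjoint A y)) y"
        by (simp add: inner_adjoint[OF A] power2_norm_eq_inner[symmetric] power2_eq_square)
      also have "\<dots> \<le> norm (A (adjoint A y)) * norm y" by (rule norm_cauchy_schwarz)
      also have "\<dots> \<le> (norm (adjoint A y) * K) * norm y" by (intro mult_right_mono K) simp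
      finally show ?thesis using False by (simp add: mult.assoc mult.commute)
    qed (use K in simp)
  qed
qed

section \<open>The metric operator\<close>

lemma bounded_linear_A_adjoint:
  fixes A :: "'x::{real_inner, complete_space} \<Rightarrow> 's::real_inner"
  assumes "bounded_linear A"
  shows "bounded_linear (A \<circ> adjoint A)"
  using bounded_linear_compose[OF assms bounded_linear_adjoint[OF assms]] by (simp add: o_def)

lemma linear_M_op:
  fixes A :: "'x::{real_inner, complete_space} \<Rightarrow> 's::real_inner"
  assumes "bounded_linear A"
  shows "linear (M_op \<gamma> \<delta> A)"
proof -
  interpret AA: bounded_linear "A \<circ> adjoint A" using bounded_linear_A_adjoint[OF assms] .
  show ?thesis
    using AA.add AA.scaleR
    by (intro linearI) (simp_all add: M_op_def algebra_simps)
qed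

lemma M_op_self_adjoint:
  fixes A :: "'x::{real_inner, complete_space} \<Rightarrow> 's::real_inner"
  assumes "bounded_linear A"
  shows "inner (M_op \<gamma> \<delta> A s) t = inner s (M_op \<gamma> \<delta> A t)"
proof -
  have "inner (A (adjoint A s)) t = inner s (A (adjoint A t))"
    by (metis inner_adjoint[OF assms] inner_commute)
  then show ?thesis by (simp add: M_op_def inner_simps)
qed

lemma M_op_nonneg:
  fixes A :: "'x::{real_inner, complete_space} \<Rightarrow> 's::real_inner"
  assumes A: "bounded_linear A" and "\<gamma> > 0" "\<delta> > 0" and psd: "M_pos_semidef \<gamma> \<delta> A"
  shows "0 \<le> inner s (M_op \<gamma> \<delta> A s)"
proof -
  have "inner s (A (adjoint A s)) \<le> norm s * norm ((A \<circ> adjoint A) s)"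
    using norm_cauchy_schwarz by simp
  also have "\<dots> \<le> norm s * (onorm (A \<circ> adjoint A) * norm s)"
    by (intro mult_left_mono onorm bounded_linear_A_adjoint A) simp
  finally have "(\<gamma> * \<delta>) * inner s (A (adjoint A s))
      \<le> (\<gamma> * \<delta> * onorm (A \<circ> adjoint A)) * (norm s)\<^sup>2"
    using mult_left_mono[of _ _ "\<gamma> * \<delta>"] \<open>\<gamma> > 0\<close> \<open>\<delta> > 0\<close>
    by (simp add: power2_eq_square mult_ac)
  also have "\<dots> \<le> 1 * (norm s)\<^sup>2"
    using psd unfolding M_pos_semidef_def by (intro mult_right_mono) auto
  finally show ?thesis using assms
    by (simp add: M_op_def inner_simps power2_norm_eq_inner)
qed

text \<open>
  Solving \<open>M s = y\<close> means finding a fixed point of \<open>s \<mapsto> (\<delta> / \<gamma>) y + \<gamma> \<delta> A A\<^sup>\<top> s\<close>, and positive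
  definiteness says precisely that this map is a contraction.
\<close>

lemma M_op_surj:
  fixes A :: "'x::{real_inner, complete_space} \<Rightarrow> 's::{real_inner, complete_space}"
  assumes A: "bounded_linear A" and "\<gamma> > 0" "\<delta> > 0" and pd: "M_pos_def \<gamma> \<delta> A"
  shows "surj (M_op \<gamma> \<delta> A)"
unfolding surj_def
proof
  fix y :: 's
  interpret AA: bounded_linear "A \<circ> adjoint A" using bounded_linear_A_adjoint[OF A] .
  define F where "F = (\<lambda>s. (\<delta> / \<gamma>) *\<^sub>R y + (\<gamma> * \<delta>) *\<^sub>R (A \<circ> adjoint A) s)"
  define c where "c = \<gamma> * \<delta> * onorm (A \<circ> adjoint A)"
  have c: "0 \<le> c" "c < 1"
    using pd assms onorm_pos_le[OF bounded_linear_A_adjoint[OF A]]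
    unfolding c_def M_pos_def_def by auto
  have "dist (F s) (F t) \<le> c * dist s t" for s t
  proof -
    have "F s - F t = (\<gamma> * \<delta>) *\<^sub>R (A \<circ> adjoint A) (s - t)"
      unfolding F_def by (simp only: AA.diff) (simp add: algebra_simps)
    then have "dist (F s) (F t) = (\<gamma> * \<delta>) * norm ((A \<circ> adjoint A) (s - t))"
      using assms by (simp add: dist_norm)
    also have "\<dots> \<le> (\<gamma> * \<delta>) * (onorm (A \<circ> adjoint A) * norm (s - t))"
      using assms by (intro mult_left_mono onorm bounded_linear_A_adjoint A) auto
    finally show ?thesis by (simp add: c_def dist_norm mult_ac)
  qed
  then obtain s where "F s = s" using banach_fix_type[OF c, of F] by blast
  then have "s - (\<gamma> * \<delta>) *\<^sub>R A (adjoint A s) = (\<delta> / \<gamma>) *\<^sub>R y"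
    unfolding F_def by (simp add: algebra_simps)
  then have "y = M_op \<gamma> \<delta> A s" using assms by (simp add: M_op_def)
  then show "\<exists>s. y = M_op \<gamma> \<delta> A s" ..
qed

section \<open>The averagedness inequality\<close>

text \<open>
  Young's inequality for a possibly degenerate form: nonnegativity of the form at \<open>2 \<beta> u + d\<close>.
  With \<open>u\<close> in the role of \<open>M\<^sup>-\<^sup>1 L\<close> it also makes sense when \<open>M\<close> is singular.
\<close>

lemma psd_form_young:
  fixes M :: "'s::real_inner \<Rightarrow> 's"
  assumes "linear M" and sym: "\<And>s t. inner (M s) t = inner s (M t)"
    and psd: "\<And>s. 0 \<le> inner s (M s)" and \<beta>: "\<beta> > 0"
  shows "- 2 * inner (M u) d \<le> 2 * \<beta> * inner u (M u) + inner d (M d) / (2 * \<beta>)"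
proof -
  interpret linear M by fact
  have "0 \<le> inner ((2 * \<beta>) *\<^sub>R u + d) (M ((2 * \<beta>) *\<^sub>R u + d))" by (rule psd)
  also have "\<dots> = (2 * \<beta>) * (2 * \<beta> * inner u (M u) + 2 * inner (M u) d + inner d (M d) / (2 * \<beta>))"
    using \<beta> sym[of u d] inner_commute[of d "M u"]
    by (simp add: add scale inner_simps field_simps)
  finally show ?thesis using \<beta> by (simp add: zero_le_mult_iff)
qed

text \<open>
  The computation behind the theorem, for vectors that stand for differences of two runs. The
  preimage \<open>u\<close> of \<open>L\<close> under \<open>M\<close> lets \<open>\<langle>u, M u\<rangle>\<close> replace the squared \<open>M\<^sup>-\<^sup>1\<close>-norm of \<open>L\<close>; when the
  gradient of the conjugate of \<open>l\<close> is constant, \<open>u = 0\<close> serves and \<open>M\<close> may be singular.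
\<close>

lemma PD3O_energy_inequality:
  fixes A :: "'x::{real_inner, complete_space} \<Rightarrow> 's::real_inner"
    and z x F z' :: 'x and s s' L u :: 's and \<beta> \<gamma> \<delta> :: real
  defines "M \<equiv> M_op \<gamma> \<delta> A"
  assumes A: "bounded_linear A"
    and pos: "\<beta> > 0" "\<gamma> > 0" "\<delta> > 0"
    and psd: "\<And>s. 0 \<le> inner s (M s)"
    and prox_g: "0 \<le> inner (z - x) x"
    and prox_h: "0 \<le> inner ((s - (\<gamma> * \<delta>) *\<^sub>R A (adjoint A s)) - \<delta> *\<^sub>R L
                   + \<delta> *\<^sub>R A (2 *\<^sub>R x - z - \<gamma> *\<^sub>R F) - s') s'"
    and z': "z' = x - \<gamma> *\<^sub>R F - \<gamma> *\<^sub>R adjoint A s'"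
    and coco_F: "\<beta> * (norm F)\<^sup>2 \<le> inner x F"
    and coco_L: "L = M u" "\<beta> * inner u (M u) \<le> inner s L"
  shows "((norm z')\<^sup>2 + inner s' (M s')) - ((norm z)\<^sup>2 + inner s (M s))
    \<le> - ((2 * \<beta> - \<gamma>) / (2 * \<beta>)) * ((norm (z' - z))\<^sup>2 + inner (s' - s) (M (s' - s)))"
proof -
  interpret A: bounded_linear A by fact
  interpret B: bounded_linear "adjoint A" using bounded_linear_adjoint[OF A] .
  have linM: "linear M" unfolding M_def using linear_M_op[OF A] .
  interpret M: linear M by fact
  have sym: "inner (M s) t = inner s (M t)" for s t
    unfolding M_def using M_op_self_adjoint[OF A] .
  \<comment> \<open>the dual proximal step in the metric \<open>M\<close>, with \<open>A\<^sup>\<top> s'\<close> eliminated through the update of \<open>z'\<close>\<close>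
  have dual: "inner (M (s' - s)) s' \<le> - \<gamma> * inner L s' + inner (x - z + z') (x - \<gamma> *\<^sub>R F - z')"
  proof -
    have As': "\<gamma> *\<^sub>R adjoint A s' = x - \<gamma> *\<^sub>R F - z'" using z' by simp
    have split: "2 *\<^sub>R x - z - \<gamma> *\<^sub>R F = (x - z + z') + \<gamma> *\<^sub>R adjoint A s'"
      using As' by (simp add: scaleR_2)
    have "(\<gamma> / \<delta>) *\<^sub>R ((s - (\<gamma> * \<delta>) *\<^sub>R A (adjoint A s)) - \<delta> *\<^sub>R L
            + \<delta> *\<^sub>R A (2 *\<^sub>R x - z - \<gamma> *\<^sub>R F) - s')
        = \<gamma> *\<^sub>R A (x - z + z') - M (s' - s) - \<gamma> *\<^sub>R L"
      unfolding split M_def M_op_def using pos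
      by (simp only: A.add A.diff B.diff A.scale) (simp add: algebra_simps)
    moreover have "0 \<le> (\<gamma> / \<delta>) * inner ((s - (\<gamma> * \<delta>) *\<^sub>R A (adjoint A s)) - \<delta> *\<^sub>R L
            + \<delta> *\<^sub>R A (2 *\<^sub>R x - z - \<gamma> *\<^sub>R F) - s') s'"
      using prox_h pos by simp
    ultimately have "0 \<le> inner (\<gamma> *\<^sub>R A (x - z + z') - M (s' - s) - \<gamma> *\<^sub>R L) s'"
      by (metis inner_scaleR_left)
    moreover have "inner (\<gamma> *\<^sub>R A (x - z + z')) s' = inner (x - z + z') (\<gamma> *\<^sub>R adjoint A s')"
      by (simp add: inner_adjoint[OF A])
    ultimately show ?thesis unfolding As' by (simp add: inner_diff_left)
  qed
  have "((norm z')\<^sup>2 + inner s' (M s')) - ((norm z)\<^sup>2 + inner s (M s))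
      = 2 * inner (z' - z) z' + 2 * inner (M (s' - s)) s'
        - ((norm (z' - z))\<^sup>2 + inner (s' - s) (M (s' - s)))"
    using sym[of s s'] sym[of s s]
    by (simp add: M.diff inner_simps power2_norm_eq_inner inner_commute)
  \<comment> \<open>all products of \<open>z\<close>, \<open>z'\<close> and \<open>x\<close> combine to the single one controlled by the primal proximal step\<close>
  also have "2 * inner (z' - z) z' + 2 * inner (M (s' - s)) s'
      \<le> - 2 * inner (z - x) x - 2 * \<gamma> * inner x F - 2 * \<gamma> * inner (z' - z) F
        - 2 * \<gamma> * inner L s - 2 * \<gamma> * inner L (s' - s)"
    using dual by (simp add: inner_simps inner_commute algebra_simps)
  also have "\<dots> \<le> (\<gamma> / (2 * \<beta>)) * ((norm (z' - z))\<^sup>2 + inner (s' - s) (M (s' - s)))"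
  proof -
    have "- 2 * inner F (z' - z) \<le> 2 * \<beta> * (norm F)\<^sup>2 + (norm (z' - z))\<^sup>2 / (2 * \<beta>)"
      using psd_form_young[of "\<lambda>x. x" \<beta> F "z' - z"] pos
      by (simp add: linear_id[unfolded id_def] power2_norm_eq_inner)
    then have 1: "- 2 * inner x F - 2 * inner (z' - z) F \<le> (norm (z' - z))\<^sup>2 / (2 * \<beta>)"
      using coco_F by (simp add: inner_commute)
    have 2: "- 2 * inner L s - 2 * inner L (s' - s) \<le> inner (s' - s) (M (s' - s)) / (2 * \<beta>)"
      using psd_form_young[OF linM sym psd pos(1), of u "s' - s"] coco_L
      by (simp add: inner_commute)
    have "- 2 * \<gamma> * inner x F - 2 * \<gamma> * inner (z' - z) F - 2 * \<gamma> * inner L s - 2 * \<gamma> * inner L (s' - s)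
        = \<gamma> * ((- 2 * inner x F - 2 * inner (z' - z) F) + (- 2 * inner L s - 2 * inner L (s' - s)))"
      by (simp add: algebra_simps)
    also have "\<dots> \<le> \<gamma> * ((norm (z' - z))\<^sup>2 / (2 * \<beta>) + inner (s' - s) (M (s' - s)) / (2 * \<beta>))"
      using add_mono[OF 1 2] pos by (intro mult_left_mono) auto
    also have "\<dots> = (\<gamma> / (2 * \<beta>)) * ((norm (z' - z))\<^sup>2 + inner (s' - s) (M (s' - s)))"
      by (simp add: add_divide_distrib distrib_left)
    finally show ?thesis using prox_g by linarith
  qed
  finally show ?thesis using pos by (simp add: field_simps)
qed

lemma averaged_imp_nonexpansive:
  assumes "averaged_under N \<alpha> T" "\<And>u. 0 \<le> N u"
  shows "nonexpansive_under N T"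
  unfolding nonexpansive_under_def
proof (intro allI)
  fix u v
  have "0 \<le> (1 - \<alpha>) / \<alpha> * (N ((u - T u) - (v - T v)))\<^sup>2"
    using assms(1) by (simp add: averaged_under_def)
  then have "(N (T u - T v))\<^sup>2 \<le> (N (u - v))\<^sup>2"
    using assms(1) unfolding averaged_under_def by (smt (verit))
  then show "N (T u - T v) \<le> N (u - v)" using assms(2) by (rule power2_le_imp_le)
qed

lemma norm_IM_squared:
  fixes M :: "'s::real_inner \<Rightarrow> 's"
  assumes "\<And>s. 0 \<le> inner s (M s)"
  shows "(norm_IM M (z, s))\<^sup>2 = (norm z)\<^sup>2 + inner s (M s)"
  using assms by (simp add: norm_IM_def weighted_norm_def)

text \<open>
  Unifies the two branches of the standing assumption: a constant gradient gives the preimage \<open>0\<close>,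
  and otherwise \<open>M\<close> is surjective, so the chosen inverse really yields a preimage and the
  squared \<open>M\<^sup>-\<^sup>1\<close>-norm is \<open>\<langle>u, M u\<rangle>\<close>.
\<close>

lemma conjugate_gradient_difference_in_range_M:
  fixes A :: "'x::{real_inner, complete_space} \<Rightarrow> 's::{real_inner, complete_space}"
  assumes A: "bounded_linear A" and pos: "\<gamma> > 0" "\<delta> > 0"
    and st: "standing_assumption \<beta> \<gamma> \<delta> A f l"
  obtains u where "grad (conjugate_real l) s\<^sub>1 - grad (conjugate_real l) s\<^sub>2 = M_op \<gamma> \<delta> A u"
    "\<beta> * inner u (M_op \<gamma> \<delta> A u)
       \<le> inner (s\<^sub>1 - s\<^sub>2) (grad (conjugate_real l) s\<^sub>1 - grad (conjugate_real l) s\<^sub>2)"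
proof (cases "grad (conjugate_real l) constant_on UNIV")
  case True
  then have "grad (conjugate_real l) s\<^sub>1 - grad (conjugate_real l) s\<^sub>2 = 0"
    unfolding constant_on_def by auto
  then show thesis using that[of 0] linear_0[OF linear_M_op[OF A]] by simp
next
  case False
  define L where "L = grad (conjugate_real l) s\<^sub>1 - grad (conjugate_real l) s\<^sub>2"
  define u where "u = inv (M_op \<gamma> \<delta> A) L"
  have pd: "M_pos_def \<gamma> \<delta> A"
    and coco: "inner (s\<^sub>1 - s\<^sub>2) L \<ge> \<beta> * (weighted_norm (inv (M_op \<gamma> \<delta> A)) L)\<^sup>2"
    using st False unfolding standing_assumption_def L_def by auto
  have L: "L = M_op \<gamma> \<delta> A u"
    unfolding u_def using surj_f_inv_f[OF M_op_surj[OF A pos pd]] by metis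
  have "0 \<le> inner u (M_op \<gamma> \<delta> A u)"
    using M_op_nonneg[OF A pos] pd by (simp add: M_pos_semidef_def M_pos_def_def)
  then have "(weighted_norm (inv (M_op \<gamma> \<delta> A)) L)\<^sup>2 = inner u (M_op \<gamma> \<delta> A u)"
    unfolding weighted_norm_def u_def[symmetric] by (simp add: L[symmetric] inner_commute)
  then show thesis using that[OF L[unfolded L_def]] coco unfolding L_def by simp
qed

theorem PD3O_contraction_inequality:
  fixes A :: "'x::{real_inner, complete_space} \<Rightarrow> 's::{real_inner, complete_space}"
    and u v :: "'x \<times> 's"
  assumes A: "bounded_linear A" and g: "proper_lsc_convex g" and h: "proper_lsc_convex h"
    and pos: "\<gamma> > 0" "\<delta> > 0" and st: "standing_assumption \<beta> \<gamma> \<delta> A f l"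
  defines "T \<equiv> T_PD3O \<gamma> \<delta> A f g h l" and "N \<equiv> norm_IM (M_op \<gamma> \<delta> A)"
  shows "(N (T u - T v))\<^sup>2 - (N (u - v))\<^sup>2
    \<le> - ((2 * \<beta> - \<gamma>) / (2 * \<beta>)) * (N ((T u - T v) - (u - v)))\<^sup>2"
proof -
  interpret A: bounded_linear A by fact
  interpret B: bounded_linear "adjoint A" using bounded_linear_adjoint[OF A] .
  obtain z1 s1 z2 s2 where uv: "u = (z1, s1)" "v = (z2, s2)" by force
  obtain z1' s1' z2' s2' where T: "T u = (z1', s1')" "T v = (z2', s2')" by force
  have psd: "0 \<le> inner s (M_op \<gamma> \<delta> A s)" for s
    using M_op_nonneg[OF A pos] st
    by (auto simp: standing_assumption_def M_pos_semidef_def M_pos_def_def split: if_splits)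
  have \<beta>: "\<beta> > 0" using st by (simp add: standing_assumption_def)
  define x1 where "x1 = prox \<gamma> g z1"
  define x2 where "x2 = prox \<gamma> g z2"
  define L where "L = grad (conjugate_real l) s1 - grad (conjugate_real l) s2"
  define F where "F = grad f x1 - grad f x2"
  obtain w where w: "L = M_op \<gamma> \<delta> A w" "\<beta> * inner w (M_op \<gamma> \<delta> A w) \<le> inner (s1 - s2) L"
    using conjugate_gradient_difference_in_range_M[OF A pos st] unfolding L_def by blast
  define q where "q = (\<lambda>z s x. (s - (\<gamma> * \<delta>) *\<^sub>R A (adjoint A s)) - \<delta> *\<^sub>R grad (conjugate_real l) s
                  + \<delta> *\<^sub>R A (2 *\<^sub>R x - z - \<gamma> *\<^sub>R grad f x))"
  have s': "s1' = prox \<delta> (conjugate h) (q z1 s1 x1)" "s2' = prox \<delta> (conjugate h) (q z2 s2 x2)"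
    and z': "z1' = x1 - \<gamma> *\<^sub>R grad f x1 - \<gamma> *\<^sub>R adjoint A s1'"
      "z2' = x2 - \<gamma> *\<^sub>R grad f x2 - \<gamma> *\<^sub>R adjoint A s2'"
    using T unfolding T_def uv T_PD3O_def Let_def x1_def x2_def q_def by auto
  have q_diff: "q z1 s1 x1 - q z2 s2 x2
      = ((s1 - s2) - (\<gamma> * \<delta>) *\<^sub>R A (adjoint A (s1 - s2))) - \<delta> *\<^sub>R L
        + \<delta> *\<^sub>R A (2 *\<^sub>R (x1 - x2) - (z1 - z2) - \<gamma> *\<^sub>R F)"
    unfolding q_def L_def F_def
    by (simp only: A.diff A.scaleR B.diff) (simp add: algebra_simps)
  have "((norm (z1' - z2'))\<^sup>2 + inner (s1' - s2') (M_op \<gamma> \<delta> A (s1' - s2')))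
      - ((norm (z1 - z2))\<^sup>2 + inner (s1 - s2) (M_op \<gamma> \<delta> A (s1 - s2)))
    \<le> - ((2 * \<beta> - \<gamma>) / (2 * \<beta>)) * ((norm ((z1' - z2') - (z1 - z2)))\<^sup>2
        + inner ((s1' - s2') - (s1 - s2)) (M_op \<gamma> \<delta> A ((s1' - s2') - (s1 - s2))))"
  proof (rule PD3O_energy_inequality[where x = "x1 - x2" and F = F and L = L and u = w])
    show "0 \<le> inner (z1 - z2 - (x1 - x2)) (x1 - x2)"
      using prox_firmly_nonexpansive[OF g pos(1), of z1 z2] unfolding x1_def x2_def
      by (simp add: algebra_simps)
    show "0 \<le> inner ((s1 - s2 - (\<gamma> * \<delta>) *\<^sub>R A (adjoint A (s1 - s2))) - \<delta> *\<^sub>R L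
        + \<delta> *\<^sub>R A (2 *\<^sub>R (x1 - x2) - (z1 - z2) - \<gamma> *\<^sub>R F) - (s1' - s2')) (s1' - s2')"
      using prox_firmly_nonexpansive[OF proper_lsc_convex_conjugate[OF h] pos(2),
          of "q z1 s1 x1" "q z2 s2 x2"]
      unfolding s'[symmetric] q_diff[symmetric] by (simp add: algebra_simps)
    show "z1' - z2' = x1 - x2 - \<gamma> *\<^sub>R F - \<gamma> *\<^sub>R adjoint A (s1' - s2')"
      unfolding z' F_def by (simp add: B.diff algebra_simps)
    show "\<beta> * (norm F)\<^sup>2 \<le> inner (x1 - x2) F"
      using st unfolding standing_assumption_def F_def by blast
  qed (use A \<beta> pos psd w in simp_all)
  then show ?thesis
    unfolding T N_def using uv by (simp add: norm_IM_squared[OF psd])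
qed

theorem lemma3:
  fixes A :: "'x::{real_inner, complete_space} \<Rightarrow> 's::{real_inner, complete_space}"
    and f :: "'x \<Rightarrow> real" and g :: "'x \<Rightarrow> ereal" and h l :: "'s \<Rightarrow> ereal"
    and \<beta> \<gamma> \<delta> :: real
  assumes "bounded_linear A"
    and "proper_lsc_convex (\<lambda>x. ereal (f x))" and "proper_lsc_convex g"
    and "proper_lsc_convex h" and "proper_lsc_convex l"
    and "lipschitz_smooth f"
    and "\<forall>s. \<bar>conjugate l s\<bar> \<noteq> \<infinity>" and "lipschitz_smooth (conjugate_real l)"
    and "\<gamma> > 0" and "\<delta> > 0"
    and "standing_assumption \<beta> \<gamma> \<delta> A f l"
  shows "(\<forall>z\<^sub>1 s\<^sub>1 z\<^sub>2 s\<^sub>2 z\<^sub>1' s\<^sub>1' z\<^sub>2' s\<^sub>2'.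
            (z\<^sub>1', s\<^sub>1') = T_PD3O \<gamma> \<delta> A f g h l (z\<^sub>1, s\<^sub>1) \<longrightarrow>
            (z\<^sub>2', s\<^sub>2') = T_PD3O \<gamma> \<delta> A f g h l (z\<^sub>2, s\<^sub>2) \<longrightarrow>
            (norm_IM (M_op \<gamma> \<delta> A) ((z\<^sub>1', s\<^sub>1') - (z\<^sub>2', s\<^sub>2')))\<^sup>2
              - (norm_IM (M_op \<gamma> \<delta> A) ((z\<^sub>1, s\<^sub>1) - (z\<^sub>2, s\<^sub>2)))\<^sup>2
            \<le> - ((2 * \<beta> - \<gamma>) / (2 * \<beta>)) *
                (norm_IM (M_op \<gamma> \<delta> A)
                   ((z\<^sub>1', s\<^sub>1') - (z\<^sub>1, s\<^sub>1) - (z\<^sub>2', s\<^sub>2') + (z\<^sub>2, s\<^sub>2)))\<^sup>2)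
       \<and> (M_pos_def \<gamma> \<delta> A \<and> \<gamma> \<le> 2 * \<beta> \<longrightarrow>
            nonexpansive_under (norm_IM (M_op \<gamma> \<delta> A)) (T_PD3O \<gamma> \<delta> A f g h l) \<and>
            averaged_under (norm_IM (M_op \<gamma> \<delta> A)) (2 * \<beta> / (4 * \<beta> - \<gamma>))
              (T_PD3O \<gamma> \<delta> A f g h l))"
proof -
  define T where "T = T_PD3O \<gamma> \<delta> A f g h l"
  define N where "N = (norm_IM (M_op \<gamma> \<delta> A) :: 'x \<times> 's \<Rightarrow> real)"
  have ineq: "(N (T u - T v))\<^sup>2 - (N (u - v))\<^sup>2
      \<le> - ((2 * \<beta> - \<gamma>) / (2 * \<beta>)) * (N ((T u - T v) - (u - v)))\<^sup>2" for u v
    unfolding T_def N_def using assms by (intro PD3O_contraction_inequality)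
  have \<beta>: "\<beta> > 0" using assms by (simp add: standing_assumption_def)
  have averaged: "averaged_under N (2 * \<beta> / (4 * \<beta> - \<gamma>)) T" if "\<gamma> \<le> 2 * \<beta>"
  proof -
    let ?\<alpha> = "2 * \<beta> / (4 * \<beta> - \<gamma>)"
    have \<alpha>: "0 < ?\<alpha>" "?\<alpha> \<le> 1" "(1 - ?\<alpha>) / ?\<alpha> = (2 * \<beta> - \<gamma>) / (2 * \<beta>)"
      using that \<beta> by (auto simp: field_simps)
    have N_minus: "N (- w) = N w" for w
      using linear_neg[OF linear_M_op[OF assms(1)]]
      by (cases w) (simp add: N_def norm_IM_def weighted_norm_def)
    have "N ((u - T u) - (v - T v)) = N ((T u - T v) - (u - v))" for u v
      using N_minus[of "(T u - T v) - (u - v)"] by (simp add: algebra_simps)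
    then show ?thesis
      unfolding averaged_under_def \<alpha>(3) using ineq \<alpha>(1,2) by (simp add: algebra_simps)
  qed
  have "0 \<le> N w" for w
    by (cases w) (simp add: N_def norm_IM_def weighted_norm_def)
  with averaged have "nonexpansive_under N T" if "\<gamma> \<le> 2 * \<beta>"
    using that averaged_imp_nonexpansive by blast
  moreover have "(N ((z\<^sub>1', s\<^sub>1') - (z\<^sub>2', s\<^sub>2')))\<^sup>2 - (N ((z\<^sub>1, s\<^sub>1) - (z\<^sub>2, s\<^sub>2)))\<^sup>2
      \<le> - ((2 * \<beta> - \<gamma>) / (2 * \<beta>)) *
          (N ((z\<^sub>1', s\<^sub>1') - (z\<^sub>1, s\<^sub>1) - (z\<^sub>2', s\<^sub>2') + (z\<^sub>2, s\<^sub>2)))\<^sup>2"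
    if "(z\<^sub>1', s\<^sub>1') = T (z\<^sub>1, s\<^sub>1)" "(z\<^sub>2', s\<^sub>2') = T (z\<^sub>2, s\<^sub>2)"
    for z\<^sub>1 s\<^sub>1 z\<^sub>2 s\<^sub>2 z\<^sub>1' s\<^sub>1' z\<^sub>2' s\<^sub>2'
    using ineq[of "(z\<^sub>1, s\<^sub>1)" "(z\<^sub>2, s\<^sub>2)"] unfolding that[symmetric]
    by (simp add: algebra_simps)
  ultimately show ?thesis using averaged unfolding T_def N_def by blast
qed

end
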